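(* The idempotent 3D slice $\mathcal{T}_{e}(\gamma_1\gamma_3,\overline{\gamma_1}\gamma_3,\gamma_1\overline{\gamma_3})$ of the tricomplex Mandelbrot set (the Earthbrot) is, in the coordinates given by the basis $\{\gamma_1\gamma_3,\overline{\gamma_1}\gamma_3,\gamma_1\overline{\gamma_3}\}$, a cube with edge length $\frac{9}{4}$.
   Context: The tricomplex numbers $\mathbb{TC}$ form the commutative, associative unital real algebra generated by three commuting elements $\mathbf{i_1},\mathbf{i_2},\mathbf{i_3}$ with $\mathbf{i_1}^2=\mathbf{i_2}^2=\mathbf{i_3}^2=-1$; it has dimension 8 over $\mathbb{R}$ with basis $1,\mathbf{i_1},\mathbf{i_2},\mathbf{j_1},\mathbf{i_3},\mathbf{j_2},\mathbf{j_3},\mathbf{i_4}$, where $\mathbf{j_1}=\mathbf{i_1}\mathbf{i_2}$, $\mathbf{j_2}=\mathbf{i_1}\mathbf{i_3}$, $\mathbf{j_3}=\mathbf{i_2}\mathbf{i_3}$ and $\mathbf{i_4}=\mathbf{i_1}\mathbf{i_2}\mathbf{i_3}$. Boundedness in $\mathbb{TC}\cong\mathbb{R}^8$ is with respect to the Euclidean norm. For $c\in\mathbb{TC}$ let $P_c(\eta)=\eta^2+c$ and let $P_c^{(n)}$ be its $n$-fold composition. The tricomplex Mandelbrot set is $\mathcal{M}_3=\{c\in\mathbb{TC}:\{P_c^{(n)}(0)\}_{n\in\mathbb{N}}\text{ is bounded}\}$. Put $\gamma_1=\frac{1+\mathbf{j_1}}{2}$, $\overline{\gamma_1}=\frac{1-\mathbf{j_1}}{2}$,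 $\gamma_3=\frac{1+\mathbf{j_3}}{2}$, $\overline{\gamma_3}=\frac{1-\mathbf{j_3}}{2}$; these are idempotents of $\mathbb{TC}$. The idempotent 3D slice is $\mathcal{T}_{e}(\gamma_1\gamma_3,\overline{\gamma_1}\gamma_3,\gamma_1\overline{\gamma_3})=\mathrm{span}_{\mathbb{R}}\{\gamma_1\gamma_3,\overline{\gamma_1}\gamma_3,\gamma_1\overline{\gamma_3}\}\cap\mathcal{M}_3$. Its geometry is understood by identifying $x_1\gamma_1\gamma_3+x_2\overline{\gamma_1}\gamma_3+x_3\gamma_1\overline{\gamma_3}$ with the point $(x_1,x_2,x_3)$ of Euclidean $\mathbb{R}^3$; "cube" means the solid cube. *)

theory Defs
  imports "HOL-Analysis.Analysis"
begin

text \<open>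
  Adjunction of a new commuting square root of \<open>-1\<close> to a commutative ring: \<open>Adj a b\<close> stands for
  \<open>a + b \<i>'\<close>. Starting from the complex numbers, two adjunctions yield the tricomplex numbers.
  The inner product is chosen so that the norm is the Euclidean norm of the real coordinates.
\<close>

datatype 'a adj = Adj (base_part: 'a) (new_part: 'a)

lemma adj_eq_iff: "x = y \<longleftrightarrow> base_part x = base_part y \<and> new_part x = new_part y"
  by (cases x; cases y) simp

instantiation adj :: (ab_group_add) ab_group_add
begin

definition "0 = Adj 0 0"
definition "x + y = Adj (base_part x + base_part y) (new_part x + new_part y)"
definition "- x = Adj (- base_part x) (- new_part x)"
definition "x - y = Adj (base_part x - base_part y) (new_part x - new_part y)"

instance
  by standard
    (simp_all add: zero_adj_def plus_adj_def uminus_adj_def minus_adj_def algebra_simps)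

end

instantiation adj :: (comm_ring_1) comm_ring_1
begin

definition "1 = Adj 1 0"
definition "x * y =
  Adj (base_part x * base_part y - new_part x * new_part y)
      (base_part x * new_part y + new_part x * base_part y)"

instance
  by standard
    (simp_all add: zero_adj_def plus_adj_def one_adj_def times_adj_def algebra_simps)

end

instantiation adj :: (real_vector) real_vector
begin

definition "r *\<^sub>R x = Adj (r *\<^sub>R base_part x) (r *\<^sub>R new_part x)"

instance
  by standard (simp_all add: plus_adj_def scaleR_adj_def scaleR_add_right scaleR_add_left)

end

instance adj :: ("{comm_ring_1, real_algebra_1}") real_algebra_1
  by standard
    (simp_all add: plus_adj_def scaleR_adj_def times_adj_def scaleR_diff_right scaleR_add_right)

instantiation adj :: (real_inner) real_inner
begin

definition "inner x y = inner (base_part x) (base_part y) + inner (new_part x) (new_part y)"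
definition "norm x = sqrt (inner x x)" for x :: "'a adj"
definition "sgn x = inverse (norm x) *\<^sub>R x" for x :: "'a adj"
definition "dist x y = norm (x - y)" for x y :: "'a adj"
definition "uniformity = (INF e\<in>{0<..}. principal {(x :: 'a adj, y). dist x y < e})"
definition "open U \<longleftrightarrow> (\<forall>x\<in>U. \<forall>\<^sub>F (x', y) in uniformity. x' = x \<longrightarrow> y \<in> U)"
  for U :: "'a adj set"

instance
proof
  fix x y z :: "'a adj" and r :: real
  show "inner x y = inner y x"
    by (simp add: inner_adj_def inner_commute)
  show "inner (x + y) z = inner x z + inner y z"
    by (simp add: inner_adj_def plus_adj_def inner_add_left)
  show "inner (r *\<^sub>R x) y = r * inner x y"
    by (simp add: inner_adj_def scaleR_adj_def distrib_left)
  show "0 \<le> inner x x"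
    by (simp add: inner_adj_def)
  show "inner x x = 0 \<longleftrightarrow> x = 0"
    by (simp add: inner_adj_def zero_adj_def adj_eq_iff add_nonneg_eq_0_iff)
qed (rule norm_adj_def sgn_adj_def dist_adj_def uniformity_adj_def open_adj_def)+

end

type_synonym tricomplex = "complex adj adj"

definition i1 :: tricomplex where "i1 = Adj (Adj \<i> 0) 0"
definition i2 :: tricomplex where "i2 = Adj (Adj 0 1) 0"
definition i3 :: tricomplex where "i3 = Adj 0 1"
definition i4 :: tricomplex where "i4 = i1 * i2 * i3"
definition j1 :: tricomplex where "j1 = i1 * i2"
definition j2 :: tricomplex where "j2 = i1 * i3"
definition j3 :: tricomplex where "j3 = i2 * i3"

lemmas unit_defs = i1_def i2_def i3_def i4_def j1_def j2_def j3_def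
lemmas adj_defs = zero_adj_def plus_adj_def uminus_adj_def minus_adj_def one_adj_def
  times_adj_def scaleR_adj_def

lemma unit_squares: "i1\<^sup>2 = -1" "i2\<^sup>2 = -1" "i3\<^sup>2 = -1"
  by (simp_all add: unit_defs adj_defs power2_eq_square)

text \<open>The elements \<open>1, i1, i2, j1, i3, j2, j3, i4\<close> form an orthonormal real basis.\<close>

lemma tricomplex_coords:
  "a *\<^sub>R 1 + b *\<^sub>R i1 + c *\<^sub>R i2 + d *\<^sub>R j1 + e *\<^sub>R i3 + f *\<^sub>R j2 + g *\<^sub>R j3 + h *\<^sub>R i4
    = Adj (Adj (Complex a b) (Complex c d)) (Adj (Complex e f) (Complex g h))"
  by (simp add: unit_defs adj_defs complex_eq_iff)

lemma tricomplex_coords_exist: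
  "\<exists>a b c d e f g h. \<eta> =
    a *\<^sub>R 1 + b *\<^sub>R i1 + c *\<^sub>R i2 + d *\<^sub>R j1 + e *\<^sub>R i3 + f *\<^sub>R j2 + g *\<^sub>R j3 + h *\<^sub>R i4"
  unfolding tricomplex_coords by (metis adj.exhaust complex.exhaust)

lemma norm_tricomplex:
  "norm (a *\<^sub>R 1 + b *\<^sub>R i1 + c *\<^sub>R i2 + d *\<^sub>R j1 + e *\<^sub>R i3 + f *\<^sub>R j2 + g *\<^sub>R j3 + h *\<^sub>R i4)
    = sqrt (a\<^sup>2 + b\<^sup>2 + c\<^sup>2 + d\<^sup>2 + e\<^sup>2 + f\<^sup>2 + g\<^sup>2 + h\<^sup>2)"
  unfolding tricomplex_coords
  by (simp add: norm_adj_def inner_adj_def inner_complex_def power2_eq_square algebra_simps)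

definition P :: "tricomplex \<Rightarrow> tricomplex \<Rightarrow> tricomplex"
  where "P c \<eta> = \<eta>\<^sup>2 + c"

definition M3 :: "tricomplex set"
  where "M3 = {c. bounded (range (\<lambda>n. (P c ^^ n) 0))}"

definition \<gamma>1 :: tricomplex where "\<gamma>1 = (1/2) *\<^sub>R (1 + j1)"
definition \<gamma>1_bar :: tricomplex where "\<gamma>1_bar = (1/2) *\<^sub>R (1 - j1)"
definition \<gamma>3 :: tricomplex where "\<gamma>3 = (1/2) *\<^sub>R (1 + j3)"
definition \<gamma>3_bar :: tricomplex where "\<gamma>3_bar = (1/2) *\<^sub>R (1 - j3)"

definition idempotent_slice :: "tricomplex \<Rightarrow> tricomplex \<Rightarrow> tricomplex \<Rightarrow> tricomplex set"
  where "idempotent_slice u v w = span {u, v, w} \<inter> M3"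

definition from_coords :: "tricomplex \<Rightarrow> tricomplex \<Rightarrow> tricomplex \<Rightarrow> real ^ 3 \<Rightarrow> tricomplex"
  where "from_coords u v w x = (x $ 1) *\<^sub>R u + (x $ 2) *\<^sub>R v + (x $ 3) *\<^sub>R w"

lemma range_from_coords: "range (from_coords u v w) = span {u, v, w}"
proof (intro subset_antisym subsetI)
  fix y assume "y \<in> range (from_coords u v w)"
  then show "y \<in> span {u, v, w}"
    unfolding from_coords_def by (blast intro: span_add span_scale span_base)
next
  fix y assume "y \<in> span {u, v, w}"
  then obtain a b c where "y - a *\<^sub>R u - b *\<^sub>R v = c *\<^sub>R w"
    unfolding span_insert[of u] span_insert[of v] span_singleton by blast
  then have "y = from_coords u v w (vector [a, b, c])"
    by (simp add: from_coords_def diff_eq_eq add.commute)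
  then show "y \<in> range (from_coords u v w)"
    by blast
qed

lemma idempotent_basis_expansion:
  "from_coords (\<gamma>1 * \<gamma>3) (\<gamma>1_bar * \<gamma>3) (\<gamma>1 * \<gamma>3_bar) x
    = (1/4) *\<^sub>R ((x $ 1 + x $ 2 + x $ 3) *\<^sub>R 1 + (x $ 1 - x $ 2 + x $ 3) *\<^sub>R j1
        + (x $ 1 + x $ 2 - x $ 3) *\<^sub>R j3 + (- x $ 1 + x $ 2 + x $ 3) *\<^sub>R j2)"
  by (simp add: from_coords_def \<gamma>1_def \<gamma>1_bar_def \<gamma>3_def \<gamma>3_bar_def unit_defs adj_defs
    complex_eq_iff field_simps)

lemma inj_from_coords: "inj (from_coords (\<gamma>1 * \<gamma>3) (\<gamma>1_bar * \<gamma>3) (\<gamma>1 * \<gamma>3_bar))"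
proof (rule injI)
  fix x y :: "real ^ 3"
  assume "from_coords (\<gamma>1 * \<gamma>3) (\<gamma>1_bar * \<gamma>3) (\<gamma>1 * \<gamma>3_bar) x
    = from_coords (\<gamma>1 * \<gamma>3) (\<gamma>1_bar * \<gamma>3) (\<gamma>1 * \<gamma>3_bar) y"
  then have "x $ 1 + x $ 2 + x $ 3 = y $ 1 + y $ 2 + y $ 3"
    "x $ 1 - x $ 2 + x $ 3 = y $ 1 - y $ 2 + y $ 3"
    "x $ 1 + x $ 2 - x $ 3 = y $ 1 + y $ 2 - y $ 3"
    unfolding idempotent_basis_expansion
    by (simp_all add: unit_defs adj_defs complex_eq_iff)
  then show "x = y"
    unfolding vec_eq_iff forall_3 by linarith
qed

text \<open>A solid cube in arbitrary position: the image of \<open>[0,a]\<^sup>3\<close> under a rigid motion.\<close>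

definition is_cube :: "real \<Rightarrow> (real ^ 3) set \<Rightarrow> bool"
  where "is_cube a S \<longleftrightarrow> a > 0 \<and>
    (\<exists>p. \<exists>f :: real ^ 3 \<Rightarrow> real ^ 3. orthogonal_transformation f \<and>
      S = (\<lambda>x. p + f x) ` cbox 0 (\<chi> i. a))"

end

theory Submission imports Defs begin

text \<open>
  The three elements \<open>\<gamma>1 * \<gamma>3\<close>, \<open>\<gamma>1_bar * \<gamma>3\<close>, \<open>\<gamma>1 * \<gamma>3_bar\<close> are mutually orthogonal idempotents.
  On their real span multiplication is therefore coordinatewise, and the tricomplex orbit of \<open>0\<close>
  under \<open>\<eta> \<mapsto> \<eta>\<^sup>2 + c\<close> splits into three independent orbits of real quadratic maps
  \<open>t \<mapsto> t\<^sup>2 + x\<^sub>k\<close>, one for each coordinate \<open>x\<^sub>k\<close> of \<open>c\<close> (\<open>orbit_slice_point\<close>). The coordinate map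
  only halves the Euclidean norm (\<open>norm_slice_point\<close>), so the tricomplex orbit is bounded exactly
  when all three real orbits are. A real quadratic orbit of \<open>0\<close> is bounded exactly for parameters
  in \<open>[-2, 1/4]\<close>, the real section of the classical Mandelbrot set
  (\<open>bounded_real_orbit_iff\<close>). Hence the slice is \<open>[-2, 1/4]\<^sup>3\<close>, whose edges have length
  \<open>1/4 + 2 = 9/4\<close>.
\<close>

abbreviation real_orbit :: "real \<Rightarrow> nat \<Rightarrow> real"
  where "real_orbit c n \<equiv> ((\<lambda>t. t\<^sup>2 + c) ^^ n) 0"

text \<open>
  For \<open>0 \<le> c \<le> 1/4\<close> the interval \<open>[0, 1/2]\<close> is mapped into itself; for \<open>-2 \<le> c \<le> 0\<close> the
  interval \<open>[c, -c]\<close> is, since \<open>c\<^sup>2 + c \<le> -c\<close> there.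
\<close>

lemma bounded_real_orbit:
  assumes "-2 \<le> c" "c \<le> 1/4"
  shows "bounded (range (real_orbit c))"
proof (cases "c \<ge> 0")
  case True
  have "0 \<le> real_orbit c n \<and> real_orbit c n \<le> 1/2" for n
  proof (induction n)
    case (Suc n)
    then have "(real_orbit c n)\<^sup>2 \<le> (1/2)\<^sup>2"
      by (intro power_mono) auto
    with True assms show ?case
      by (simp add: power2_eq_square)
  qed simp
  then have "range (real_orbit c) \<subseteq> {0..1/2}"
    by auto
  then show ?thesis
    using bounded_closed_interval bounded_subset by blast
next
  case False
  have "\<bar>real_orbit c n\<bar> \<le> -c" for n
  proof (induction n)
    case (Suc n)
    then have "(real_orbit c n)\<^sup>2 \<le> (-c)\<^sup>2"
      by (metis abs_ge_zero power2_abs power_mono)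
    moreover have "c\<^sup>2 \<le> -2 * c"
      using mult_nonneg_nonneg[of "-c" "c + 2"] False assms
      by (simp add: power2_eq_square algebra_simps)
    moreover have "0 \<le> (real_orbit c n)\<^sup>2"
      by simp
    ultimately show ?case
      unfolding funpow.simps o_apply abs_le_iff power2_minus by linarith
  qed (use False in simp)
  then show ?thesis
    by (auto intro!: boundedI)
qed

lemma unbounded_if_linear_growth:
  fixes f :: "nat \<Rightarrow> real"
  assumes "d > 0" and growth: "\<And>n. real n * d \<le> f (n + k)"
  shows "\<not> bounded (range f)"
proof
  assume "bounded (range f)"
  then obtain B where B: "\<And>n. \<bar>f n\<bar> \<le> B"
    by (auto simp: bounded_iff)
  obtain n where "B < real n * d"
    using reals_Archimedean3[OF \<open>d > 0\<close>] by blast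
  with growth[of n] B[of "n + k"] show False
    by linarith
qed

text \<open>
  To the right of \<open>1/4\<close> the map has no fixed point, and every step advances by at least the minimum
  \<open>c - 1/4\<close> of \<open>t\<^sup>2 + c - t\<close>.
\<close>

lemma unbounded_real_orbit_right:
  assumes "c > 1/4"
  shows "\<not> bounded (range (real_orbit c))"
proof (rule unbounded_if_linear_growth[where d = "c - 1/4" and k = 0])
  fix n show "real n * (c - 1/4) \<le> real_orbit c (n + 0)"
  proof (induction n)
    case (Suc n)
    have "0 \<le> (real_orbit c n - 1/2)\<^sup>2"
      by simp
    then have step: "real_orbit c n + (c - 1/4) \<le> real_orbit c (Suc n)"
      by (simp add: power2_eq_square algebra_simps)
    show ?case
      using order_trans[OF add_right_mono[OF Suc[unfolded Nat.add_0_right]] step]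
      by (simp only: of_nat_Suc distrib_right mult_1 add.commute add_0_left)
  qed simp
qed (use assms in simp)

text \<open>
  To the left of \<open>-2\<close> the second iterate \<open>c\<^sup>2 + c\<close> already exceeds \<open>-c > 2\<close>, and from any
  \<open>t \<ge> -c\<close> one step leads to \<open>t\<^sup>2 + c \<ge> t + t * (t - 2) \<ge> t + (-c - 2)\<close>.
\<close>

lemma unbounded_real_orbit_left:
  assumes "c < -2"
  shows "\<not> bounded (range (real_orbit c))"
proof (rule unbounded_if_linear_growth[where d = "-c - 2" and k = 2])
  fix n
  have "-c + real n * (-c - 2) \<le> real_orbit c (n + 2)"
  proof (induction n)
    case 0
    have "0 \<le> (-c) * (-c - 2)"
      using assms by (intro mult_nonneg_nonneg) auto
    then show ?case
      by (simp add: numeral_2_eq_2 power2_eq_square algebra_simps)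
  next
    case (Suc n)
    let ?t = "real_orbit c (n + 2)"
    have "0 \<le> real n * (-c - 2)"
      using assms by simp
    then have t: "-c \<le> ?t"
      using Suc by linarith
    then have "1 * (-c - 2) \<le> ?t * (?t - 2)"
      using assms by (intro mult_mono) auto
    with t have "?t + (-c - 2) \<le> ?t\<^sup>2 + c"
      unfolding power2_eq_square right_diff_distrib by linarith
    with Suc show ?case
      by (simp add: algebra_simps)
  qed
  with assms show "real n * (-c - 2) \<le> real_orbit c (n + 2)"
    by linarith
qed (use assms in simp)

lemma bounded_real_orbit_iff: "bounded (range (real_orbit c)) \<longleftrightarrow> -2 \<le> c \<and> c \<le> 1/4"
  using bounded_real_orbit unbounded_real_orbit_left unbounded_real_orbit_right
  by (meson not_le)

abbreviation slice_point :: "real ^ 3 \<Rightarrow> tricomplex"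
  where "slice_point \<equiv> from_coords (\<gamma>1 * \<gamma>3) (\<gamma>1_bar * \<gamma>3) (\<gamma>1 * \<gamma>3_bar)"

lemma from_coords_power2:
  assumes "u * u = u" "v * v = v" "w * w = w" "u * v = 0" "u * w = 0" "v * w = 0"
  shows "(from_coords u v w x)\<^sup>2 = from_coords u v w (\<chi> k. (x $ k)\<^sup>2)"
proof -
  have "v * u = 0" "w * u = 0" "w * v = 0"
    using assms by (simp_all add: mult.commute)
  with assms show ?thesis
    by (simp add: from_coords_def power2_eq_square distrib_left distrib_right)
qed

lemma gamma_idempotent:
  "\<gamma>1 * \<gamma>1 = \<gamma>1" "\<gamma>1_bar * \<gamma>1_bar = \<gamma>1_bar" "\<gamma>3 * \<gamma>3 = \<gamma>3" "\<gamma>3_bar * \<gamma>3_bar = \<gamma>3_bar"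
  by (simp_all add: \<gamma>1_def \<gamma>1_bar_def \<gamma>3_def \<gamma>3_bar_def unit_defs adj_defs complex_eq_iff)

lemma gamma_orthogonal: "\<gamma>1 * \<gamma>1_bar = 0" "\<gamma>3 * \<gamma>3_bar = 0"
  by (simp_all add: \<gamma>1_def \<gamma>1_bar_def \<gamma>3_def \<gamma>3_bar_def unit_defs adj_defs complex_eq_iff)

lemma mult_regroup: "(a * b) * (c * d) = (a * c) * (b * d)" for a b c d :: tricomplex
  by (simp only: mult.assoc mult.left_commute)

lemma slice_basis_idempotent:
  "(\<gamma>1 * \<gamma>3) * (\<gamma>1 * \<gamma>3) = \<gamma>1 * \<gamma>3"
  "(\<gamma>1_bar * \<gamma>3) * (\<gamma>1_bar * \<gamma>3) = \<gamma>1_bar * \<gamma>3"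
  "(\<gamma>1 * \<gamma>3_bar) * (\<gamma>1 * \<gamma>3_bar) = \<gamma>1 * \<gamma>3_bar"
  by (simp_all only: mult_regroup[of \<gamma>1 _ \<gamma>1] mult_regroup[of \<gamma>1_bar _ \<gamma>1_bar] gamma_idempotent)

lemma slice_basis_orthogonal:
  "(\<gamma>1 * \<gamma>3) * (\<gamma>1_bar * \<gamma>3) = 0"
  "(\<gamma>1 * \<gamma>3) * (\<gamma>1 * \<gamma>3_bar) = 0"
  "(\<gamma>1_bar * \<gamma>3) * (\<gamma>1 * \<gamma>3_bar) = 0"
  by (simp_all only: mult_regroup[of \<gamma>1 _ \<gamma>1_bar] mult_regroup[of \<gamma>1 \<gamma>3 \<gamma>1 \<gamma>3_bar]
      mult_regroup[of \<gamma>1_bar \<gamma>3 \<gamma>1] gamma_orthogonal mult_zero_left mult_zero_right)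

text \<open>
  Squaring and adding \<open>c\<close> both act coordinatewise in an orthogonal idempotent basis, so the
  iteration never leaves the span and its coordinates evolve without interacting.
\<close>

lemma orbit_slice_point:
  "(P (slice_point x) ^^ n) 0 = slice_point (\<chi> k. real_orbit (x $ k) n)"
proof (induction n)
  case 0
  show ?case
    by (simp add: from_coords_def)
next
  case (Suc n)
  have "(P (slice_point x) ^^ Suc n) 0
      = (slice_point (\<chi> k. real_orbit (x $ k) n))\<^sup>2 + slice_point x"
    by (simp add: Suc P_def)
  also have "\<dots> = slice_point (\<chi> k. (real_orbit (x $ k) n)\<^sup>2) + slice_point x"
    by (simp add: from_coords_power2[OF slice_basis_idempotent slice_basis_orthogonal])
  also have "\<dots> = slice_point (\<chi> k. real_orbit (x $ k) (Suc n))"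
    by (simp add: from_coords_def scaleR_add_left)
  finally show ?case .
qed

text \<open>
  In the orthonormal elements \<open>1, j1, j3, j2\<close> the coefficients are, up to the factor \<open>1/4\<close>, sums
  \<open>\<plusminus>x\<^sub>1 \<plusminus> x\<^sub>2 \<plusminus> x\<^sub>3\<close> whose sign patterns make all mixed products cancel in the sum of the four
  squares. What remains is \<open>4 * (1/4)\<^sup>2 = 1/4\<close> of the squared norm.
\<close>

lemma norm_slice_point: "norm (slice_point x) = norm x / 2"
proof -
  have "(norm (slice_point x))\<^sup>2 = (norm x / 2)\<^sup>2"
    unfolding idempotent_basis_expansion
    by (simp add: power2_norm_eq_inner inner_adj_def inner_complex_def inner_vec_def sum_3
        unit_defs adj_defs power_divide)
      (simp add: power2_eq_square field_simps)
  then show ?thesis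
    by (metis norm_ge_zero divide_nonneg_pos zero_less_numeral power2_eq_iff_nonneg)
qed

lemma bounded_range_cart_iff:
  fixes f :: "'a \<Rightarrow> real ^ 'n"
  shows "bounded (range f) \<longleftrightarrow> (\<forall>k. bounded (range (\<lambda>n. f n $ k)))"
proof
  assume "bounded (range f)"
  then show "\<forall>k. bounded (range (\<lambda>n. f n $ k))"
    using bounded_component_cart[of "range f"] by (simp add: image_image)
next
  assume "\<forall>k. bounded (range (\<lambda>n. f n $ k))"
  then have "\<exists>B. \<forall>n. \<bar>f n $ k\<bar> \<le> B" for k
    by (auto simp: bounded_iff)
  then obtain B where B: "\<And>k n. \<bar>f n $ k\<bar> \<le> B k"
    by metis
  have "norm (f n) \<le> sum B UNIV" for n
    using norm_le_l1_cart[of "f n"] sum_mono[of UNIV "\<lambda>k. \<bar>f n $ k\<bar>" B] B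
    by (meson order_trans)
  then show "bounded (range f)"
    by (auto intro!: boundedI)
qed

lemma slice_point_in_M3_iff: "slice_point x \<in> M3 \<longleftrightarrow> (\<forall>k. -2 \<le> x $ k \<and> x $ k \<le> 1/4)"
proof -
  let ?orbit = "\<lambda>n. \<chi> k. real_orbit (x $ k) n"
  have "slice_point x \<in> M3 \<longleftrightarrow> bounded (range (\<lambda>n. slice_point (?orbit n)))"
    by (simp add: M3_def orbit_slice_point)
  also have "\<dots> \<longleftrightarrow> bounded (range ?orbit)"
  proof -
    have "(\<exists>B. \<forall>n. norm (?orbit n) / 2 \<le> B) \<longleftrightarrow> (\<exists>B. \<forall>n. norm (?orbit n) \<le> B)"
    proof
      assume "\<exists>B. \<forall>n. norm (?orbit n) / 2 \<le> B"
      then obtain B where "\<And>n. norm (?orbit n) / 2 \<le> B"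
        by blast
      then have "\<forall>n. norm (?orbit n) \<le> 2 * B"
        by (simp add: field_simps)
      then show "\<exists>B. \<forall>n. norm (?orbit n) \<le> B" ..
    next
      assume "\<exists>B. \<forall>n. norm (?orbit n) \<le> B"
      then obtain B where "\<And>n. norm (?orbit n) \<le> B"
        by blast
      then have "\<forall>n. norm (?orbit n) / 2 \<le> B / 2"
        by (simp add: divide_right_mono)
      then show "\<exists>B. \<forall>n. norm (?orbit n) / 2 \<le> B" ..
    qed
    then show ?thesis
      by (simp add: bounded_iff norm_slice_point)
  qed
  also have "\<dots> \<longleftrightarrow> (\<forall>k. -2 \<le> x $ k \<and> x $ k \<le> 1/4)"
    by (simp add: bounded_range_cart_iff bounded_real_orbit_iff)
  finally show ?thesis .
qed

theorem proposition9:
  "is_cube (9/4)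
    (from_coords (\<gamma>1 * \<gamma>3) (\<gamma>1_bar * \<gamma>3) (\<gamma>1 * \<gamma>3_bar) -`
      idempotent_slice (\<gamma>1 * \<gamma>3) (\<gamma>1_bar * \<gamma>3) (\<gamma>1 * \<gamma>3_bar))"
proof -
  \<comment> \<open>The cube is axis-parallel with least corner \<open>?p\<close>, so the rigid motion is a translation.\<close>
  let ?p = "(\<chi> k. -2) :: real ^ 3"
  let ?cube = "cbox 0 (\<chi> k. 9/4) :: (real ^ 3) set"
  have "slice_point -` idempotent_slice (\<gamma>1 * \<gamma>3) (\<gamma>1_bar * \<gamma>3) (\<gamma>1 * \<gamma>3_bar)
      = {x. \<forall>k. -2 \<le> x $ k \<and> x $ k \<le> 1/4}"
    by (simp add: set_eq_iff idempotent_slice_def range_from_coords[symmetric] slice_point_in_M3_iff)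
  also have "\<dots> = (\<lambda>x. ?p + id x) ` ?cube"
  proof (intro subset_antisym subsetI)
    fix x :: "real ^ 3" assume "x \<in> {x. \<forall>k. -2 \<le> x $ k \<and> x $ k \<le> 1/4}"
    then have "0 \<le> x $ k + 2 \<and> x $ k + 2 \<le> 9/4" for k
      by (auto dest: spec[of _ k])
    then have "x - ?p \<in> ?cube"
      by (simp add: mem_box_cart)
    then show "x \<in> (\<lambda>x. ?p + id x) ` ?cube"
      by (intro image_eqI[of _ _ "x - ?p"]) auto
  next
    fix x assume "x \<in> (\<lambda>x. ?p + id x) ` ?cube"
    then obtain y where x: "x = ?p + id y" and "y \<in> ?cube"
      by blast
    then have "0 \<le> y $ k \<and> y $ k \<le> 9/4" for k
      by (simp add: mem_box_cart)
    then show "x \<in> {x. \<forall>k. -2 \<le> x $ k \<and> x $ k \<le> 1/4}"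
      by (simp add: x algebra_simps)
  qed
  finally show ?thesis
    unfolding is_cube_def using orthogonal_transformation_id
    by (intro conjI exI[of _ ?p] exI[of _ id]) (auto simp: id_def)
qed

end
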